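(* Suppose $p\in\mathbb C\langle X_1,\dots,X_g,X_1^{\intercal},\dots,X_g^{\intercal}\rangle$ is of degree $u\ge1$ and has $v$ terms. If $p$ vanishes on all $g$-tuples of unitaries of size $uv$, then $$p\in\mathcal T=(1-X_1^{\intercal}X_1,\,1-X_1X_1^{\intercal},\,\dots,\,1-X_g^{\intercal}X_g,\,1-X_gX_g^{\intercal}).$$
   Context: $\mathbb C\langle X_1,\dots,X_g,X_1^{\intercal},\dots,X_g^{\intercal}\rangle$ is the free associative unital $\mathbb C$-algebra in $2g$ freely noncommuting letters with the conjugate-linear involution exchanging $X_j$ and $X_j^{\intercal}$. The evaluation of $p$ at $A\in M_n(\mathbb C)^g$ replaces $X_j$ by $A_j$ and $X_j^{\intercal}$ by the conjugate transpose $A_j^*$. The number of terms of $p$ is the number of words with nonzero coefficient. "Unitaries of size $n$" are unitary matrices in $M_n(\mathbb C)$. $(\cdots)$ denotes the two-sided ideal generated by the listed elements. *)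

theory Defs
  imports
    "HOL-Library.Poly_Mapping"
    "HOL-Algebra.Ideal"
    "Jordan_Normal_Form.Schur_Decomposition"
begin

datatype 'g star_letter = Letter 'g | Letter_tr 'g

text \<open>
  Words are wrapped in a type of their own because the product of \<^typ>\<open>'a \<Rightarrow>\<^sub>0 'b\<close> is the convolution
  along the (additively written) monoid structure of the index type. Here addition is
  concatenation of words and \<^term>\<open>0\<close> is the empty word.
\<close>

datatype 'g star_word = Word (letters: "'g star_letter list")

instantiation star_word :: (type) monoid_add
begin

definition "0 = Word []"
definition "w + w' = Word (letters w @ letters w')"

instance
  by standard (simp_all add: zero_star_word_def plus_star_word_def)

end

type_synonym 'g free_star_alg = "'g star_word \<Rightarrow>\<^sub>0 complex"

definition gen :: "'g \<Rightarrow> 'g free_star_alg"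
  where "gen j = Poly_Mapping.single (Word [Letter j]) 1"

definition gen_tr :: "'g \<Rightarrow> 'g free_star_alg"
  where "gen_tr j = Poly_Mapping.single (Word [Letter_tr j]) 1"

definition num_terms :: "'g free_star_alg \<Rightarrow> nat"
  where "num_terms p = card (Poly_Mapping.keys p)"

text \<open>The zero polynomial gets degree 0.\<close>

definition word_degree :: "'g free_star_alg \<Rightarrow> nat"
  where "word_degree p = Max (insert 0 ((\<lambda>w. length (letters w)) ` Poly_Mapping.keys p))"

primrec eval_letter :: "('g \<Rightarrow> complex mat) \<Rightarrow> 'g star_letter \<Rightarrow> complex mat"
  where
    "eval_letter A (Letter j) = A j"
  | "eval_letter A (Letter_tr j) = mat_adjoint (A j)"

definition eval_word :: "nat \<Rightarrow> ('g \<Rightarrow> complex mat) \<Rightarrow> 'g star_word \<Rightarrow> complex mat"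
  where "eval_word n A w = foldr (\<lambda>l M. eval_letter A l * M) (letters w) (1\<^sub>m n)"

text \<open>Meaningful only when all \<^term>\<open>A j\<close> lie in \<^term>\<open>carrier_mat n n\<close>.\<close>

definition eval_alg :: "nat \<Rightarrow> ('g \<Rightarrow> complex mat) \<Rightarrow> 'g free_star_alg \<Rightarrow> complex mat"
  where "eval_alg n A p =
    (\<Oplus>\<^bsub>ring_mat TYPE(complex) n ()\<^esub> w \<in> Poly_Mapping.keys p.
      Poly_Mapping.lookup p w \<cdot>\<^sub>m eval_word n A w)"

definition unitary_mat :: "nat \<Rightarrow> complex mat \<Rightarrow> bool"
  where "unitary_mat n U \<longleftrightarrow>
    U \<in> carrier_mat n n \<and> mat_adjoint U * U = 1\<^sub>m n \<and> U * mat_adjoint U = 1\<^sub>m n"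

text \<open>
  The algebra as a ring record, to which the ideals of HOL-Algebra apply. These are two-sided,
  and they are automatically closed under complex scalars since the algebra is unital.
\<close>

definition free_star_ring :: "'g free_star_alg ring"
  where "free_star_ring = \<lparr>carrier = UNIV, monoid.mult = (*), one = 1, zero = 0, add = (+)\<rparr>"

lemma ring_free_star_ring: "ring (free_star_ring :: 'g free_star_alg ring)"
proof (unfold_locales, goal_cases)
  case (6 x y)
  then show ?case by (simp add: free_star_ring_def add.commute)
next
  case 7
  have "\<exists>y. y + x = 0 \<and> x + y = 0" for x :: "'g free_star_alg"
    by (rule exI[of _ "- x"]) simp
  then show ?case by (auto simp: free_star_ring_def Units_def)
qed (auto simp: free_star_ring_def algebra_simps Units_def)

definition unitary_ideal :: "'g free_star_alg set"
  where "unitary_ideal =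
    Idl\<^bsub>free_star_ring\<^esub> (\<Union>j. {1 - gen_tr j * gen j, 1 - gen j * gen_tr j})"

end

theory Submission
  imports Defs "HOL-Library.Sublist" "HOL-Combinatorics.Permutations"
begin

text \<open>
  Modulo the ideal every word equals its free reduction, so \<^term>\<open>p\<close> lies in the ideal as soon as
  the coefficients of the words with a common reduction always add up to zero. Suppose that this
  fails, and let \<^term>\<open>R\<close> be the finite set of reduced words whose collected coefficient does not
  vanish; it has at most \<^term>\<open>v\<close> elements, all of length at most \<^term>\<open>u\<close>. A tuple of unitaries at
  which \<^term>\<open>p\<close> does not vanish comes from the left Cayley graph of the free group: take the
  suffixes of the words in \<^term>\<open>R\<close> as a basis. Multiplication by a generator is an injection
  between subsets of this basis, hence extends to a permutation of it. A word in \<^term>\<open>R\<close> then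
  sends the basis vector of the empty word to its own basis vector, so different words have linearly
  independent values.

  This basis can have \<^term>\<open>u * v + 1\<close> elements, one too many. The excess is removed by leaving out
  a longest word \<^term>\<open>r = y # s\<close> of \<^term>\<open>R\<close>, which is a proper suffix of no other. The permutations
  still follow the other words, but nothing is known about the basis vector to which \<^term>\<open>r\<close> leads;
  it may be the end of another word too. The step of the letter \<^term>\<open>y\<close> from \<^term>\<open>s\<close>, however,
  is used by no other word, so a sign on this one step changes the value of \<^term>\<open>r\<close> and nothing
  else. If \<^term>\<open>p\<close> vanished at both choices of the sign, the coefficient of \<^term>\<open>r\<close> would be zero.

  The lemma \<open>in_unitary_ideal_if_reduced_coeff_zero\<close> is the algebraic half,
  \<open>unitaries_following_words\<close> constructs the signed permutation matrices, and
  \<open>card_suffixes_minus_word\<close> is the count that makes them fit into size \<^term>\<open>u * v\<close>.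
\<close>

section \<open>Reduced words\<close>

fun letter_inv :: "'g star_letter \<Rightarrow> 'g star_letter"
  where
    "letter_inv (Letter j) = Letter_tr j"
  | "letter_inv (Letter_tr j) = Letter j"

lemma letter_inv_letter_inv [simp]: "letter_inv (letter_inv l) = l"
  by (cases l) auto

lemma letter_inv_neq [simp]: "letter_inv l \<noteq> l" "l \<noteq> letter_inv l"
  by (cases l; simp)+

abbreviation reduced :: "'g star_letter list \<Rightarrow> bool"
  where "reduced \<equiv> successively (\<lambda>l m. m \<noteq> letter_inv l)"

text \<open>
  Left multiplication by a letter in the free group, on reduced words.
\<close>

definition push_letter :: "'g star_letter \<Rightarrow> 'g star_letter list \<Rightarrow> 'g star_letter list"
  where "push_letter l w =
    (case w of [] \<Rightarrow> [l] | m # t \<Rightarrow> if m = letter_inv l then t else l # w)"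

definition reduce :: "'g star_letter list \<Rightarrow> 'g star_letter list"
  where "reduce w = foldr push_letter w []"

lemma reduce_Nil [simp]: "reduce [] = []"
  and reduce_Cons [simp]: "reduce (l # w) = push_letter l (reduce w)"
  by (simp_all add: reduce_def)

lemma reduced_push_letter: "reduced w \<Longrightarrow> reduced (push_letter l w)"
  by (auto simp: push_letter_def successively_Cons split: list.splits)

lemma reduced_reduce: "reduced (reduce w)"
  by (induction w) (auto intro: reduced_push_letter)

lemma push_letter_eq_Cons: "reduced (l # w) \<Longrightarrow> push_letter l w = l # w"
  by (auto simp: push_letter_def successively_Cons split: list.splits)

lemma push_letter_inv_push_letter:
  "reduced w \<Longrightarrow> push_letter (letter_inv l) (push_letter l w) = w"
  by (auto simp: push_letter_def successively_Cons split: list.splits)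

lemma length_push_letter: "length (push_letter l w) \<le> Suc (length w)"
  by (auto simp: push_letter_def split: list.splits)

lemma length_reduce: "length (reduce w) \<le> length w"
proof (induction w)
  case (Cons l w)
  then show ?case using length_push_letter[of l "reduce w"] by simp
qed simp

section \<open>The ideal and reduction of words\<close>

abbreviation monomial :: "'g star_letter list \<Rightarrow> 'g free_star_alg"
  where "monomial w \<equiv> Poly_Mapping.single (Word w) 1"

lemma monomial_append: "monomial (a @ b) = monomial a * monomial b"
  by (simp add: mult_single plus_star_word_def)

lemma ideal_unitary_ideal: "ideal (unitary_ideal :: 'g free_star_alg set) free_star_ring"
  unfolding unitary_ideal_def
  by (rule ring.genideal_ideal[OF ring_free_star_ring]) (simp add: free_star_ring_def)

lemma unitary_ideal_add: "a \<in> unitary_ideal \<Longrightarrow> b \<in> unitary_ideal \<Longrightarrow> a + b \<in> unitary_ideal"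
  using additive_subgroup.a_closed[OF ideal.axioms(1)[OF ideal_unitary_ideal]]
  by (auto simp: free_star_ring_def)

lemma unitary_ideal_zero: "0 \<in> unitary_ideal"
  using additive_subgroup.zero_closed[OF ideal.axioms(1)[OF ideal_unitary_ideal]]
  by (auto simp: free_star_ring_def)

lemma unitary_ideal_mult_left: "a \<in> unitary_ideal \<Longrightarrow> x * a \<in> unitary_ideal"
  using ideal.I_l_closed[OF ideal_unitary_ideal, of a x] by (simp add: free_star_ring_def)

lemma unitary_ideal_mult_right: "a \<in> unitary_ideal \<Longrightarrow> a * x \<in> unitary_ideal"
  using ideal.I_r_closed[OF ideal_unitary_ideal, of a x] by (simp add: free_star_ring_def)

lemma unitary_ideal_uminus: "a \<in> unitary_ideal \<Longrightarrow> - a \<in> unitary_ideal"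
  using unitary_ideal_mult_left[of a "- 1"] by simp

lemma unitary_ideal_sum:
  "(\<And>i. i \<in> S \<Longrightarrow> f i \<in> unitary_ideal) \<Longrightarrow> sum f S \<in> unitary_ideal"
  by (induction S rule: infinite_finite_induct) (auto intro: unitary_ideal_zero unitary_ideal_add)

lemma unitary_ideal_letter: "1 - monomial [l] * monomial [letter_inv l] \<in> unitary_ideal"
proof -
  have "(\<Union>j. {1 - gen_tr j * gen j, 1 - gen j * gen_tr j}) \<subseteq> (unitary_ideal :: 'a free_star_alg set)"
    unfolding unitary_ideal_def
    by (rule ring.genideal_self[OF ring_free_star_ring]) (simp add: free_star_ring_def)
  then show ?thesis
    by (cases l) (auto simp: gen_def gen_tr_def)
qed

text \<open>
  Cancelling one adjacent inverse pair changes a monomial by a multiple of a generator of the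
  ideal, and reduction is a succession of such cancellations.
\<close>

lemma monomial_minus_reduce: "monomial w - monomial (reduce w) \<in> unitary_ideal"
proof (induction w)
  case Nil
  then show ?case by (simp add: unitary_ideal_zero)
next
  case (Cons l w)
  have cancel: "monomial (l # reduce w) - monomial (push_letter l (reduce w)) \<in> unitary_ideal"
  proof (cases "push_letter l (reduce w) = l # reduce w")
    case False
    then obtain t where t: "reduce w = letter_inv l # t" "push_letter l (reduce w) = t"
      by (auto simp: push_letter_def split: list.splits if_splits)
    have "monomial (l # reduce w) - monomial t
        = - ((1 - monomial [l] * monomial [letter_inv l]) * monomial t)"
      unfolding left_diff_distrib monomial_append[symmetric] by (simp add: t(1))
    then show ?thesis
      unfolding t(2)
      by (simp only:) (intro unitary_ideal_uminus unitary_ideal_mult_right unitary_ideal_letter)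
  qed (simp add: unitary_ideal_zero)
  have "monomial (l # w) - monomial (reduce (l # w))
      = monomial [l] * (monomial w - monomial (reduce w))
        + (monomial (l # reduce w) - monomial (push_letter l (reduce w)))"
    using monomial_append[of "[l]" w] monomial_append[of "[l]" "reduce w"]
    by (simp add: algebra_simps)
  then show ?case
    by (simp only:) (intro unitary_ideal_add unitary_ideal_mult_left Cons.IH cancel)
qed

text \<open>
  The coefficient of the group element \<^term>\<open>r\<close> in the image of \<^term>\<open>p\<close> in the group algebra of
  the free group.
\<close>

definition reduced_coeff :: "'g free_star_alg \<Rightarrow> 'g star_letter list \<Rightarrow> complex"
  where "reduced_coeff p r =
    (\<Sum>w \<in> Poly_Mapping.keys p. if reduce (letters w) = r then Poly_Mapping.lookup p w else 0)"

text \<open>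
  Replacing every word of \<^term>\<open>p\<close> by its reduction does not change \<^term>\<open>p\<close> modulo the ideal, and
  the hypothesis says that the result is zero.
\<close>

lemma in_unitary_ideal_if_reduced_coeff_zero:
  assumes zero: "\<And>r. reduced_coeff p r = 0"
  shows "p \<in> unitary_ideal"
proof -
  \<comment> \<open>\<^term>\<open>0\<close> is the empty word, so this is the coefficient as a scalar of the algebra.\<close>
  let ?c = "\<lambda>w. Poly_Mapping.single 0 (Poly_Mapping.lookup p w) :: 'a free_star_alg"
  have scalar: "?c w * Poly_Mapping.single u 1 = Poly_Mapping.single u (Poly_Mapping.lookup p w)" for w u
    by (simp add: mult_single)
  have p: "(\<Sum>w \<in> Poly_Mapping.keys p. ?c w * monomial (letters w)) = p"
    by (rule poly_mapping_eqI)
      (auto simp: scalar lookup_sum lookup_single when_def in_keys_iff)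
  have "(\<Sum>w \<in> Poly_Mapping.keys p. ?c w * monomial (reduce (letters w))) = 0"
  proof (rule poly_mapping_eqI)
    fix w
    show "Poly_Mapping.lookup (\<Sum>w \<in> Poly_Mapping.keys p. ?c w * monomial (reduce (letters w))) w
        = Poly_Mapping.lookup 0 w"
      using zero[of "letters w"]
      by (cases w) (simp add: scalar lookup_sum lookup_single when_def reduced_coeff_def)
  qed
  then have "p = (\<Sum>w \<in> Poly_Mapping.keys p.
      ?c w * (monomial (letters w) - monomial (reduce (letters w))))"
    using p by (simp add: right_diff_distrib sum_subtractf)
  also have "\<dots> \<in> unitary_ideal"
    by (intro unitary_ideal_sum unitary_ideal_mult_left monomial_minus_reduce)
  finally show ?thesis .
qed

section \<open>Evaluation at unitaries\<close>

lemma mat_adjoint_carrier [simp]: "A \<in> carrier_mat n n \<Longrightarrow> mat_adjoint A \<in> carrier_mat n n"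
  unfolding mat_adjoint_def by auto

lemma index_mat_adjoint:
  "A \<in> carrier_mat n n \<Longrightarrow> i < n \<Longrightarrow> j < n \<Longrightarrow> mat_adjoint A $$ (i, j) = cnj (A $$ (j, i))"
  unfolding mat_adjoint_def by (auto simp: mat_of_rows_index)

lemma eval_letter_carrier:
  "(\<And>j. A j \<in> carrier_mat n n) \<Longrightarrow> eval_letter A l \<in> carrier_mat n n"
  by (cases l) auto

lemma eval_word_Nil: "eval_word n A (Word []) = 1\<^sub>m n"
  and eval_word_Cons: "eval_word n A (Word (l # w)) = eval_letter A l * eval_word n A (Word w)"
  by (simp_all add: eval_word_def)

lemma eval_word_carrier:
  assumes "\<And>j. A j \<in> carrier_mat n n"
  shows "eval_word n A (Word w) \<in> carrier_mat n n"
proof (induction w)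
  case (Cons l w)
  then show ?case
    using eval_letter_carrier[of A n l] assms by (simp add: eval_word_Cons)
qed (simp add: eval_word_Nil)

lemma eval_letter_mult_inv:
  "(\<And>j. unitary_mat n (U j)) \<Longrightarrow> eval_letter U l * eval_letter U (letter_inv l) = 1\<^sub>m n"
  by (cases l) (auto simp: unitary_mat_def)

text \<open>
  At unitaries a letter and its formal inverse evaluate to inverse matrices, so evaluation factors
  through the free group.
\<close>

lemma eval_word_reduce:
  assumes U: "\<And>j. unitary_mat n (U j)"
  shows "eval_word n U (Word (reduce w)) = eval_word n U (Word w)"
proof (induction w)
  case (Cons l w)
  have C: "\<And>j. U j \<in> carrier_mat n n" using U by (auto simp: unitary_mat_def)
  have "eval_word n U (Word (push_letter l r)) = eval_letter U l * eval_word n U (Word r)" for r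
  proof (cases "push_letter l r = l # r")
    case False
    then obtain t where t: "r = letter_inv l # t" "push_letter l r = t"
      by (auto simp: push_letter_def split: list.splits if_splits)
    have "eval_letter U l * (eval_letter U (letter_inv l) * eval_word n U (Word t))
        = eval_letter U l * eval_letter U (letter_inv l) * eval_word n U (Word t)"
      using assoc_mult_mat[OF eval_letter_carrier eval_letter_carrier eval_word_carrier] C
      by metis
    then show ?thesis
      using eval_word_carrier[of U n t] C
      unfolding t(2) by (simp add: t(1) eval_word_Cons eval_letter_mult_inv[OF U])
  qed (simp add: eval_word_Cons)
  then show ?case using Cons.IH by (simp add: eval_word_Cons)
qed simp

lemma index_finsum_mat:
  fixes f :: "'b \<Rightarrow> 'a :: semiring_1 mat"
  assumes "finite S" and "\<And>w. w \<in> S \<Longrightarrow> f w \<in> carrier_mat n n" and ij: "i < n" "j < n"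
  shows "finsum (ring_mat TYPE('a) n b) f S $$ (i, j) = (\<Sum>w\<in>S. f w $$ (i, j))"
proof -
  interpret R: semiring "ring_mat TYPE('a) n b" by (rule semiring_mat)
  show ?thesis using assms(1,2)
  proof (induction S rule: finite_induct)
    case empty
    then show ?case using ij by (simp add: ring_mat_simps)
  next
    case (insert x S)
    have c: "f \<in> S \<rightarrow> carrier (ring_mat TYPE('a) n b)" "f x \<in> carrier (ring_mat TYPE('a) n b)"
      using insert.prems by (auto simp: ring_mat_simps)
    have "finsum (ring_mat TYPE('a) n b) f S \<in> carrier_mat n n"
      using R.finsum_closed[OF c(1)] by (simp add: ring_mat_simps)
    then show ?case
      using insert ij c by (simp add: R.finsum_insert) (simp add: ring_mat_simps)
  qed
qed

lemma index_eval_alg_unitary: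
  assumes U: "\<And>j. unitary_mat n (U j)" and ij: "i < n" "j < n"
  shows "eval_alg n U p $$ (i, j) =
    (\<Sum>r \<in> (reduce \<circ> letters) ` Poly_Mapping.keys p.
      reduced_coeff p r * eval_word n U (Word r) $$ (i, j))"
proof -
  let ?e = "\<lambda>r. eval_word n U (Word r) $$ (i, j)"
  let ?K = "Poly_Mapping.keys p"
  have C: "\<And>j. U j \<in> carrier_mat n n" using U by (auto simp: unitary_mat_def)
  have W: "eval_word n U w \<in> carrier_mat n n" for w
    using eval_word_carrier[of U n "letters w"] C by simp
  have "eval_alg n U p $$ (i, j) = (\<Sum>w \<in> ?K. Poly_Mapping.lookup p w * eval_word n U w $$ (i, j))"
    unfolding eval_alg_def using W ij
    by (subst index_finsum_mat) (auto intro!: sum.cong simp: carrier_matD[OF W])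
  also have "\<dots> = (\<Sum>w \<in> ?K. Poly_Mapping.lookup p w * ?e (reduce (letters w)))"
    using eval_word_reduce[of n U] U by (intro sum.cong) simp_all
  also have "\<dots> = (\<Sum>r \<in> (reduce \<circ> letters) ` ?K. \<Sum>w \<in> {w \<in> ?K. (reduce \<circ> letters) w = r}.
      Poly_Mapping.lookup p w * ?e (reduce (letters w)))"
    by (rule sum.image_gen) simp
  also have "\<dots> = (\<Sum>r \<in> (reduce \<circ> letters) ` ?K. reduced_coeff p r * ?e r)"
  proof (rule sum.cong)
    fix r
    have "reduced_coeff p r = (\<Sum>w \<in> {w \<in> ?K. (reduce \<circ> letters) w = r}. Poly_Mapping.lookup p w)"
      unfolding reduced_coeff_def by (subst sum.inter_filter) auto
    then show "(\<Sum>w \<in> {w \<in> ?K. (reduce \<circ> letters) w = r}.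
        Poly_Mapping.lookup p w * ?e (reduce (letters w))) = reduced_coeff p r * ?e r"
      by (auto simp: sum_distrib_right)
  qed simp
  finally show ?thesis .
qed

section \<open>Weighted permutation matrices\<close>

definition weighted_perm_mat :: "nat \<Rightarrow> (nat \<Rightarrow> nat) \<Rightarrow> (nat \<Rightarrow> complex) \<Rightarrow> complex mat"
  where "weighted_perm_mat n \<pi> \<omega> = mat n n (\<lambda>(a, b). if a = \<pi> b then \<omega> b else 0)"

lemma mult_unit_vec_eq_col:
  fixes A :: "complex mat"
  assumes "A \<in> carrier_mat n n" and "b < n"
  shows "A *\<^sub>v unit_vec n b = col A b"
  using assms by (intro eq_vecI) auto

lemma weighted_perm_mat_carrier [simp]: "weighted_perm_mat n \<pi> \<omega> \<in> carrier_mat n n"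
  by (simp add: weighted_perm_mat_def)

lemma unitary_weighted_perm_mat:
  assumes \<pi>: "\<pi> permutes {..<n}" and \<omega>: "\<And>b. cnj (\<omega> b) * \<omega> b = 1"
  shows "unitary_mat n (weighted_perm_mat n \<pi> \<omega>)"
proof -
  let ?W = "weighted_perm_mat n \<pi> \<omega>"
  have "mat_adjoint ?W * ?W = 1\<^sub>m n"
  proof (rule eq_matI)
    fix i j assume "i < dim_row (1\<^sub>m n :: complex mat)" "j < dim_col (1\<^sub>m n :: complex mat)"
    then have ij: "i < n" "j < n" by auto
    then have lt: "\<pi> i < n" "\<pi> j < n" using permutes_in_image[OF \<pi>] by auto
    have C: "mat_adjoint ?W \<in> carrier_mat n n" by simp
    have "(mat_adjoint ?W * ?W) $$ (i, j)
        = (\<Sum>k = 0..<n. mat_adjoint ?W $$ (i, k) * ?W $$ (k, j))"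
      using ij carrier_matD[OF C] carrier_matD[of ?W n n] by (simp add: scalar_prod_def)
    also have "\<dots> = (\<Sum>k = 0..<n. if k = \<pi> i then (if \<pi> i = \<pi> j then cnj (\<omega> i) * \<omega> j else 0) else 0)"
      using ij by (intro sum.cong) (auto simp: index_mat_adjoint[of _ n] weighted_perm_mat_def)
    also have "\<dots> = (1\<^sub>m n :: complex mat) $$ (i, j)"
      using lt ij \<omega> by (auto simp: inj_eq[OF permutes_inj[OF \<pi>]])
    finally show "(mat_adjoint ?W * ?W) $$ (i, j) = (1\<^sub>m n :: complex mat) $$ (i, j)" .
  qed (use carrier_matD[of "mat_adjoint ?W" n n] carrier_matD[of ?W n n] in auto)
  moreover from this have "?W * mat_adjoint ?W = 1\<^sub>m n"
    by (rule mat_mult_left_right_inverse[rotated 2]) auto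
  ultimately show ?thesis by (simp add: unitary_mat_def)
qed

lemma weighted_perm_mat_mult_unit_vec:
  assumes "b < n"
  shows "weighted_perm_mat n \<pi> \<omega> *\<^sub>v unit_vec n b = \<omega> b \<cdot>\<^sub>v unit_vec n (\<pi> b)"
  unfolding mult_unit_vec_eq_col[OF weighted_perm_mat_carrier assms] using assms
  by (intro eq_vecI) (auto simp: weighted_perm_mat_def unit_vec_def)

lemma adjoint_weighted_perm_mat_mult_unit_vec:
  assumes \<pi>: "\<pi> permutes {..<n}" and b: "b < n"
  shows "mat_adjoint (weighted_perm_mat n \<pi> \<omega>) *\<^sub>v unit_vec n b
    = cnj (\<omega> (inv_into UNIV \<pi> b)) \<cdot>\<^sub>v unit_vec n (inv_into UNIV \<pi> b)"
proof -
  let ?W = "weighted_perm_mat n \<pi> \<omega>"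
  have C: "mat_adjoint ?W \<in> carrier_mat n n" by simp
  show ?thesis
    unfolding mult_unit_vec_eq_col[OF C b] using b carrier_matD[OF C]
    by (intro eq_vecI)
      (auto simp: index_mat_adjoint[of _ n] weighted_perm_mat_def unit_vec_def
        permutes_inverses[OF \<pi>])
qed

text \<open>
  The complements of the domain and of the range of a partial injection of a finite set have the
  same size, so they can be matched arbitrarily.
\<close>

lemma ex_permutes_extending:
  assumes "finite S" and "A \<subseteq> S" and "f ` A \<subseteq> S" and "inj_on f A"
  shows "\<exists>\<pi>. \<pi> permutes S \<and> (\<forall>a\<in>A. \<pi> a = f a)"
proof -
  have fin: "finite (S - A)" "finite (S - f ` A)" using assms by auto
  have "card (S - A) = card (S - f ` A)"
    using assms by (simp add: card_Diff_subset finite_subset card_image)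
  then obtain g where g: "bij_betw g (S - A) (S - f ` A)"
    using finite_same_card_bij[OF fin] by auto
  define \<pi> where "\<pi> x = (if x \<in> A then f x else if x \<in> S then g x else x)" for x
  have "bij_betw \<pi> A (f ` A)"
    using assms(4) by (auto simp: bij_betw_def \<pi>_def inj_on_def)
  moreover have "bij_betw \<pi> (S - A) (S - f ` A)"
    using g by (rule iffD1[OF bij_betw_cong, rotated]) (auto simp: \<pi>_def)
  ultimately have "bij_betw \<pi> (A \<union> (S - A)) (f ` A \<union> (S - f ` A))"
    by (rule bij_betw_combine) auto
  moreover have "A \<union> (S - A) = S" "f ` A \<union> (S - f ` A) = S" using assms by auto
  ultimately have "\<pi> permutes S"
    using assms(2) by (intro bij_imp_permutes) (auto simp: \<pi>_def)
  then show ?thesis by (intro exI[of _ \<pi>]) (auto simp: \<pi>_def)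
qed

section \<open>Walking in the Cayley graph\<close>

text \<open>
  On reduced words, left multiplication by a generator is injective, being undone by the inverse
  letter. Restricted to the words that it keeps inside \<^term>\<open>V\<close> it is therefore a partial injection,
  and the labelling \<^term>\<open>i\<close> carries it to one of \<^term>\<open>S\<close>. The inverse letters need no separate
  treatment: a step by \<^term>\<open>Letter_tr j\<close> is a step by \<^term>\<open>Letter j\<close> taken backwards.
\<close>

lemma ex_permutations_following_words:
  fixes V :: "'g star_letter list set"
  assumes red: "\<And>t. t \<in> V \<Longrightarrow> reduced t"
    and S: "finite S" and i: "inj_on i V" "i ` V \<subseteq> S"
  obtains \<pi> :: "'g \<Rightarrow> 'b \<Rightarrow> 'b"
  where "\<And>j. \<pi> j permutes S"
    and "\<And>j t. t \<in> V \<Longrightarrow> push_letter (Letter j) t \<in> V \<Longrightarrow>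
           \<pi> j (i t) = i (push_letter (Letter j) t)"
proof -
  have "\<exists>\<pi>. \<pi> permutes S \<and>
      (\<forall>t\<in>V. push_letter (Letter j) t \<in> V \<longrightarrow> \<pi> (i t) = i (push_letter (Letter j) t))" for j :: 'g
  proof -
    let ?p = "push_letter (Letter j)"
    define D where "D = {t \<in> V. ?p t \<in> V}"
    define f where "f = i \<circ> ?p \<circ> the_inv_into V i"
    have f: "f (i t) = i (?p t)" if "t \<in> V" for t
      using that i(1) by (simp add: f_def the_inv_into_f_f)
    have p: "t = t'" if "t \<in> V" "t' \<in> V" "?p t = ?p t'" for t t'
      using push_letter_inv_push_letter red that by metis
    have "inj_on f (i ` D)"
      using i(1) by (auto simp: inj_on_def f D_def dest: p)
    moreover have "i ` D \<subseteq> S" "f ` (i ` D) \<subseteq> S" using i(2) by (auto simp: D_def f)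
    ultimately obtain \<pi> where "\<pi> permutes S" "\<forall>a \<in> i ` D. \<pi> a = f a"
      using ex_permutes_extending[OF S, of "i ` D" f] by auto
    then show ?thesis by (intro exI[of _ \<pi>]) (auto simp: D_def f)
  qed
  then have "\<exists>\<pi>. \<forall>j. \<pi> j permutes S \<and>
      (\<forall>t\<in>V. push_letter (Letter j) t \<in> V \<longrightarrow> \<pi> j (i t) = i (push_letter (Letter j) t))"
    by (intro choice allI)
  then obtain \<pi> where "\<forall>j. \<pi> j permutes S \<and>
      (\<forall>t\<in>V. push_letter (Letter j) t \<in> V \<longrightarrow> \<pi> j (i t) = i (push_letter (Letter j) t))"
    by (rule exE)
  then show ?thesis by (intro that[of \<pi>]) simp_all
qed

text \<open>
  The matrices are permutation matrices that follow the words of \<^term>\<open>V\<close>, except that the single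
  step by \<^term>\<open>y\<close> from the label of \<^term>\<open>s\<close> carries the weight \<^term>\<open>\<epsilon>\<close>. A word of \<^term>\<open>V\<close>
  never takes this step: taken forwards it would make \<^term>\<open>y # s\<close> a member of \<^term>\<open>V\<close>, and a walk
  within \<^term>\<open>V\<close> that takes it backwards starts at a word \<^term>\<open>t\<close> with
  \<^term>\<open>s = letter_inv y # t\<close>, which contradicts that \<^term>\<open>y # s\<close> is reduced. The vertex \<^term>\<open>a\<close>
  reached by \<^term>\<open>y # s\<close> is arbitrary, and it is essential that neither \<^term>\<open>a\<close> nor the labelling
  \<^term>\<open>i\<close> depends on \<^term>\<open>\<epsilon>\<close>.
\<close>

lemma unitaries_following_words:
  fixes V :: "'g star_letter list set"
  assumes V: "finite V" "card V \<le> n" "[] \<in> V"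
    and closed: "\<And>l t. l # t \<in> V \<Longrightarrow> t \<in> V"
    and red: "\<And>t. t \<in> V \<Longrightarrow> reduced t" "reduced (y # s)"
    and new: "s \<in> V" "y # s \<notin> V"
  obtains U :: "complex \<Rightarrow> 'g \<Rightarrow> complex mat" and i a
  where "a < n" and "\<And>t. t \<in> V \<Longrightarrow> i t < n"
    and "\<And>\<epsilon> j. \<epsilon> \<in> {1, -1} \<Longrightarrow> unitary_mat n (U \<epsilon> j)"
    and "\<And>\<epsilon> t. \<epsilon> \<in> {1, -1} \<Longrightarrow> t \<in> V \<Longrightarrow>
           col (eval_word n (U \<epsilon>) (Word t)) (i []) = unit_vec n (i t)"
    and "\<And>\<epsilon>. \<epsilon> \<in> {1, -1} \<Longrightarrow>
           col (eval_word n (U \<epsilon>) (Word (y # s))) (i []) = \<epsilon> \<cdot>\<^sub>v unit_vec n a"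
proof -
  obtain i :: "'g star_letter list \<Rightarrow> nat" where i: "inj_on i V" "i ` V \<subseteq> {..<n}"
    using V by (metis card_lessThan card_le_inj finite_lessThan)
  obtain \<pi> where \<pi>: "\<And>j :: 'g. \<pi> j permutes {..<n}"
    and \<pi>_push: "\<And>j t. t \<in> V \<Longrightarrow> push_letter (Letter j) t \<in> V \<Longrightarrow>
           \<pi> j (i t) = i (push_letter (Letter j) t)"
    using ex_permutations_following_words[OF red(1) finite_lessThan i] by metis
  define \<pi>l where "\<pi>l l = (case l of Letter j \<Rightarrow> \<pi> j | Letter_tr j \<Rightarrow> inv_into UNIV (\<pi> j))" for l
  have \<pi>l: "\<pi>l l permutes {..<n}" for l
    by (cases l) (auto simp: \<pi>l_def \<pi> permutes_inv)
  have \<pi>l_lt: "\<pi>l l b < n" if "b < n" for l b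
    using permutes_in_image[OF \<pi>l] that by auto
  have \<pi>l_Cons: "\<pi>l l (i t) = i (l # t)" if "l # t \<in> V" for l t
  proof (cases l)
    case (Letter j)
    then show ?thesis
      using \<pi>_push[of t j] closed that push_letter_eq_Cons[OF red(1)[OF that]]
      by (auto simp: \<pi>l_def)
  next
    case (Letter_tr j)
    then have "push_letter (Letter j) (l # t) = t" by (simp add: push_letter_def)
    then have "\<pi> j (i (l # t)) = i t" using \<pi>_push[of "l # t" j] closed that by auto
    then show ?thesis
      using permutes_inverses[OF \<pi>] by (metis Letter_tr \<pi>l_def star_letter.simps(6))
  qed
  define k where "k = i s"
  have k: "k < n" using i(2) new by (auto simp: k_def)
  \<comment> \<open>\<^term>\<open>b\<close> is the source of the step by \<^term>\<open>Letter j\<close>. If \<^term>\<open>y\<close> is \<^term>\<open>Letter_tr j\<close>, the weighted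
    step is taken backwards by \<^term>\<open>y\<close>, so it is recognised by its target.\<close>
  define \<omega> where "\<omega> \<epsilon> j b =
    (if (y = Letter j \<and> b = k) \<or> (y = Letter_tr j \<and> \<pi> j b = k) then \<epsilon> else 1)" for \<epsilon> :: complex and j b
  define U where "U \<epsilon> j = weighted_perm_mat n (\<pi> j) (\<omega> \<epsilon> j)" for \<epsilon> j
  have unitary: "unitary_mat n (U \<epsilon> j)" if "\<epsilon> \<in> {1, -1}" for \<epsilon> j
    unfolding U_def by (rule unitary_weighted_perm_mat[OF \<pi>]) (use that in \<open>auto simp: \<omega>_def\<close>)
  have act: "eval_letter (U \<epsilon>) l *\<^sub>v unit_vec n b =
      (if (l = y \<and> b = k) \<or> (l = letter_inv y \<and> \<pi>l l b = k) then \<epsilon> else 1) \<cdot>\<^sub>v unit_vec n (\<pi>l l b)"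
    if "\<epsilon> \<in> {1, -1}" "b < n" for \<epsilon> l b
  proof (cases l)
    case (Letter j)
    then show ?thesis
      using that by (cases y) (auto simp: U_def weighted_perm_mat_mult_unit_vec \<omega>_def \<pi>l_def)
  next
    case (Letter_tr j)
    then show ?thesis
      using that
      by (cases y) (auto simp: U_def adjoint_weighted_perm_mat_mult_unit_vec[OF \<pi>] \<omega>_def \<pi>l_def
          permutes_inverses[OF \<pi>])
  qed
  have i0: "i [] < n" using i(2) V by auto
  have col_Cons: "col (eval_word n (U \<epsilon>) (Word (l # t))) (i [])
      = eval_letter (U \<epsilon>) l *\<^sub>v col (eval_word n (U \<epsilon>) (Word t)) (i [])" for \<epsilon> l t
  proof -
    have "\<And>j. U \<epsilon> j \<in> carrier_mat n n" by (simp add: U_def)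
    then show ?thesis
      unfolding eval_word_Cons
      using col_mult2[OF eval_letter_carrier eval_word_carrier i0] by metis
  qed
  have walk: "col (eval_word n (U \<epsilon>) (Word t)) (i []) = unit_vec n (i t)"
    if \<epsilon>: "\<epsilon> \<in> {1, -1}" and "t \<in> V" for \<epsilon> t
    using that(2)
  proof (induction t)
    case Nil
    then show ?case using i0 by (simp add: eval_word_Nil)
  next
    case (Cons l t)
    have t: "t \<in> V" using closed Cons.prems .
    \<comment> \<open>Neither direction of the weighted step occurs.\<close>
    have "\<not> (l = y \<and> i t = k)"
      using Cons.prems new t inj_onD[OF i(1)] by (auto simp: k_def)
    moreover have "\<not> (l = letter_inv y \<and> i (l # t) = k)"
      using Cons.prems new red(2) inj_onD[OF i(1), of "l # t" s] by (auto simp: k_def)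
    ultimately show ?case
      using Cons.IH[OF t] act[OF \<epsilon>, of "i t" l] i(2) t \<pi>l_Cons[OF Cons.prems]
      by (auto simp: col_Cons)
  qed
  have last: "col (eval_word n (U \<epsilon>) (Word (y # s))) (i []) = \<epsilon> \<cdot>\<^sub>v unit_vec n (\<pi>l y k)"
    if "\<epsilon> \<in> {1, -1}" for \<epsilon>
    using act[OF that k, of y] walk[OF that new(1)] by (simp add: col_Cons k_def)
  show ?thesis
  proof (rule that[of "\<pi>l y k" i U])
    show "\<And>t. t \<in> V \<Longrightarrow> i t < n" using i(2) by auto
  qed (use \<pi>l_lt k unitary walk last in auto)
qed

text \<open>
  Each word has at most \<^term>\<open>u\<close> nonempty suffixes, and the empty word is shared by all. Dropping
  one nonempty word pays for the empty word; this is what brings the size down from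
  \<^term>\<open>card R * u + 1\<close> to \<^term>\<open>card R * u\<close>.
\<close>

lemma card_suffixes_minus_word:
  assumes R: "finite R" and r: "r \<in> R" "r \<noteq> []" and len: "\<And>r'. r' \<in> R \<Longrightarrow> length r' \<le> u"
  shows "card ((\<Union>r'\<in>R. set (suffixes r')) - {r}) \<le> card R * u"
proof -
  define W where "W = (\<Union>r'\<in>R. set (suffixes r') - {[]})"
  have W: "finite W" "r \<in> W" using R r by (auto simp: W_def)
  have "(\<Union>r'\<in>R. set (suffixes r')) - {r} = insert [] (W - {r})"
    using r by (auto simp: W_def)
  also have "card \<dots> \<le> Suc (card (W - {r}))" by (rule card_insert_le_m1) auto
  also have "\<dots> = card W" using card_Suc_Diff1[OF W] .
  also have "\<dots> \<le> (\<Sum>r'\<in>R. card (set (suffixes r') - {[]}))"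
    unfolding W_def by (rule card_UN_le[OF R])
  also have "\<dots> = (\<Sum>r'\<in>R. length r')"
    by (intro sum.cong) (auto simp: card_Diff_subset)
  also have "\<dots> \<le> card R * u" using sum_bounded_above[of R length u] len by simp
  finally show ?thesis .
qed

theorem theorem4p6:
  fixes p :: "'g::finite free_star_alg" and u v :: nat
  assumes "word_degree p = u" and "u \<ge> 1" and "num_terms p = v"
    and "\<And>U :: 'g \<Rightarrow> complex mat.
      (\<And>j. unitary_mat (u * v) (U j)) \<Longrightarrow> eval_alg (u * v) U p = 0\<^sub>m (u * v) (u * v)"
  shows "p \<in> unitary_ideal"
proof (rule ccontr)
  assume notin: "p \<notin> unitary_ideal"
  let ?n = "u * v"
  define K where "K = (reduce \<circ> letters) ` Poly_Mapping.keys p"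
  define R where "R = {r \<in> K. reduced_coeff p r \<noteq> 0}"
  have entry: "(\<Sum>r\<in>R. reduced_coeff p r * eval_word ?n U (Word r) $$ (a, b)) = 0"
    if U: "\<And>j. unitary_mat ?n (U j)" and ab: "a < ?n" "b < ?n" for U a b
  proof -
    have "(\<Sum>r\<in>R. reduced_coeff p r * eval_word ?n U (Word r) $$ (a, b))
        = (\<Sum>r\<in>K. reduced_coeff p r * eval_word ?n U (Word r) $$ (a, b))"
      by (rule sum.mono_neutral_left) (auto simp: K_def R_def)
    also have "\<dots> = eval_alg ?n U p $$ (a, b)"
      using index_eval_alg_unitary[where p = p, OF U ab] by (simp add: K_def)
    finally show ?thesis using assms(4)[of U] U ab by simp
  qed
  have finK: "finite K" and cardK: "card K \<le> v"
    using assms(3) card_image_le[of "Poly_Mapping.keys p" "reduce \<circ> letters"]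
    by (auto simp: K_def num_terms_def)
  have finR: "finite R" and cardR: "card R \<le> v"
    using finK cardK card_mono[of K R] by (auto simp: R_def)
  have redR: "reduced r" if "r \<in> R" for r
    using that by (auto simp: R_def K_def reduced_reduce)
  have lenR: "length r \<le> u" if rR: "r \<in> R" for r
  proof -
    obtain w where w: "w \<in> Poly_Mapping.keys p" "r = reduce (letters w)"
      using rR by (auto simp: R_def K_def)
    then have "length (letters w) \<le> u"
      unfolding assms(1)[symmetric] word_degree_def by (intro Max_ge) auto
    then show ?thesis using length_reduce[of "letters w"] w by simp
  qed
  have "\<exists>r. reduced_coeff p r \<noteq> 0"
    using notin in_unitary_ideal_if_reduced_coeff_zero by blast
  moreover have "r \<in> K" if "reduced_coeff p r \<noteq> 0" for r
  proof (rule ccontr)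
    assume "r \<notin> K"
    then have "reduced_coeff p r = 0"
      unfolding reduced_coeff_def by (intro sum.neutral) (auto simp: K_def)
    with that show False by simp
  qed
  ultimately have "R \<noteq> {}" by (auto simp: R_def)
  then have "Max (length ` R) \<in> length ` R" using finR by (intro Max_in) auto
  then obtain r where r: "r \<in> R" and "length r = Max (length ` R)" by auto
  then have r_max: "length s \<le> length r" if "s \<in> R" for s
    using finR that by simp
  have cr: "reduced_coeff p r \<noteq> 0" using r by (simp add: R_def)
  show False
  proof (cases r)
    case Nil
    \<comment> \<open>The value of \<^term>\<open>p\<close> is a nonzero scalar, so any unitary of positive size will do.\<close>
    have "R = {[]}" using r_max r Nil by auto
    moreover have "unitary_mat ?n (weighted_perm_mat ?n id (\<lambda>_. 1))"
      by (rule unitary_weighted_perm_mat) (auto simp: permutes_id)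
    moreover have "card R > 0" using r finR card_gt_0_iff by blast
    then have "?n > 0" using assms(2) cardR by auto
    ultimately show False
      using entry[of "\<lambda>_. weighted_perm_mat ?n id (\<lambda>_. 1)" 0 0] cr Nil by (simp add: eval_word_Nil)
  next
    case (Cons y s)
    define V where "V = (\<Union>r'\<in>R. set (suffixes r')) - {r}"
    have finV: "finite V" using finR by (simp add: V_def)
    have r_suffix: "r' = r" if "r' \<in> R" "suffix r r'" for r'
      using r_max[OF that(1)] that(2) by (auto simp: suffix_def)
    have cardV: "card V \<le> ?n"
    proof -
      have "card V \<le> card R * u"
        unfolding V_def using card_suffixes_minus_word[OF finR r _ lenR] Cons by simp
      also have "\<dots> \<le> ?n" using cardR by simp
      finally show ?thesis .
    qed
    have NilV: "[] \<in> V" using r Cons by (auto simp: V_def)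
    have rV: "r \<notin> V" by (simp add: V_def)
    have sV: "s \<in> V" using r Cons by (auto simp: V_def intro!: bexI[of _ r] suffix_ConsI)
    \<comment> \<open>Removing \<^term>\<open>r\<close> leaves a suffix-closed set because \<^term>\<open>r\<close> has maximal length.\<close>
    have closedV: "t \<in> V" if lt: "l # t \<in> V" for l t
    proof -
      obtain r' where r': "r' \<in> R" "suffix (l # t) r'" "l # t \<noteq> r" using lt by (auto simp: V_def)
      then have suf: "suffix t r'" by (metis suffix_ConsD)
      have "t \<noteq> r"
      proof
        assume "t = r"
        then have "r' = r" using r_suffix r' suf by auto
        then show False using r'(2) \<open>t = r\<close> suffix_length_le by fastforce
      qed
      then show ?thesis using suf r' by (auto simp: V_def)
    qed
    have redV: "reduced t" if "t \<in> V" for t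
      using that by (auto simp: V_def suffix_def successively_append_iff dest!: redR)
    have RV: "R - {r} \<subseteq> V" by (auto simp: V_def)
    have red_ys: "reduced (y # s)" using redR[OF r] Cons by simp
    have ysV: "y # s \<notin> V" using rV Cons by simp
    show False
    proof (rule unitaries_following_words[of V ?n y s])
      fix U :: "complex \<Rightarrow> 'g \<Rightarrow> complex mat" and i a
      assume a: "a < ?n" and i: "\<And>t. t \<in> V \<Longrightarrow> i t < ?n"
        and U: "\<And>\<epsilon> j. \<epsilon> \<in> {1, -1} \<Longrightarrow> unitary_mat ?n (U \<epsilon> j)"
        and walk: "\<And>\<epsilon> t. \<epsilon> \<in> {1, -1} \<Longrightarrow> t \<in> V \<Longrightarrow>
           col (eval_word ?n (U \<epsilon>) (Word t)) (i []) = unit_vec ?n (i t)"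
        and last: "\<And>\<epsilon>. \<epsilon> \<in> {1, -1} \<Longrightarrow>
           col (eval_word ?n (U \<epsilon>) (Word (y # s))) (i []) = \<epsilon> \<cdot>\<^sub>v unit_vec ?n a"
      \<comment> \<open>Row \<^term>\<open>a\<close> sees the vector reached by \<^term>\<open>r\<close>, and possibly the ends of other words; the
        contribution of the latter does not depend on the sign.\<close>
      let ?rest = "\<Sum>t \<in> R - {r}. reduced_coeff p t * unit_vec ?n (i t) $ a"
      have "reduced_coeff p r * \<epsilon> + ?rest = 0" if \<epsilon>: "\<epsilon> \<in> {1, -1}" for \<epsilon>
      proof -
        have C: "\<And>j. U \<epsilon> j \<in> carrier_mat ?n ?n" using U[OF \<epsilon>] by (auto simp: unitary_mat_def)
        have ix: "eval_word ?n (U \<epsilon>) (Word t) $$ (a, i []) = col (eval_word ?n (U \<epsilon>) (Word t)) (i []) $ a" for t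
          using a i[OF NilV] eval_word_carrier[of "U \<epsilon>" ?n t, OF C] by simp
        have "0 = (\<Sum>t\<in>R. reduced_coeff p t * col (eval_word ?n (U \<epsilon>) (Word t)) (i []) $ a)"
          using entry[of "U \<epsilon>", OF U[OF \<epsilon>] a i[OF NilV]] by (simp add: ix)
        also have "\<dots> = reduced_coeff p r * \<epsilon>
            + (\<Sum>t \<in> R - {r}. reduced_coeff p t * col (eval_word ?n (U \<epsilon>) (Word t)) (i []) $ a)"
          using a by (simp add: sum.remove[OF finR r] last[OF \<epsilon>, folded Cons])
        also have "(\<Sum>t \<in> R - {r}. reduced_coeff p t * col (eval_word ?n (U \<epsilon>) (Word t)) (i []) $ a) = ?rest"
          using RV by (intro sum.cong) (auto simp: walk[OF \<epsilon>])
        finally show ?thesis by simp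
      qed
      from this[of 1] this[of "-1"] have "reduced_coeff p r = 0" by simp
      with cr show False by simp
    qed (fact finV cardV NilV closedV redV red_ys sV ysV)+
  qed
qed

end
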